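(* Let $(X,d_X,\leq_{P_1})$ and $(Y,d_Y,\leq_{P_2})$ be two partially ordered complete metric spaces. Let $F:X\times Y\rightarrow X$ and $G:Y\times X\rightarrow Y$ be two continuous functions having the mixed monotone property. Assume that there exist $k,l,m,n\in \left[0,\frac{1}{2}\right)$ satisfying $$d_X(F(x,y),F(u,v))\leq k\, d_X(x,F(x,y))+l\, d_X(u, F(u,v))\quad \text{for all } x,u\in X,\ y,v\in Y \text{ with } x\geq_{P_1}u,\ y\leq_{P_2}v,$$ $$d_Y(G(y,x),G(v,u))\leq m\, d_Y(y,G(y,x))+n\, d_Y(v,G(v,u))\quad \text{for all } x,u\in X,\ y,v\in Y \text{ with } x\leq_{P_1}u,\ y\geq_{P_2}v.$$ If there exist $x_0\in X$, $y_0\in Y$ satisfying $x_0\leq_{P_1} F(x_0, y_0)$ and $y_0\geq_{P_2} G(y_0, x_0)$, then there exist $x\in X$, $y\in Y$ such that $x=F(x,y)$ and $y=G(y,x)$.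
   Context: A partially ordered complete metric space $(X,d_X,\leq_{P_1})$ is a set $X$ with a metric $d_X$ for which it is complete and a partial order $\leq_{P_1}$ (no compatibility between them is assumed). The product $X\times Y$ carries the metric $d((x,y),(u,v))=d_X(x,u)+d_Y(y,v)$ (similarly for $Y\times X$). The maps $F:X\times Y\to X$ and $G:Y\times X\to Y$ have the mixed monotone property if for all $x\in X$, $y\in Y$: for all $x_1,x_2\in X$, $x_1\leq_{P_1} x_2$ implies $F(x_1,y)\leq_{P_1} F(x_2,y)$ and $G(y,x_1)\geq_{P_2}G(y,x_2)$; and for all $y_1,y_2\in Y$, $y_1\leq_{P_2}y_2$ implies $F(x,y_1)\geq_{P_1}F(x,y_2)$ and $G(y_1,x)\leq_{P_2}G(y_2,x)$. *)

theory Defs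
  imports "HOL-Analysis.Analysis"
begin

text \<open>\<open>(x, y) \<in> P\<close> reads \<open>x \<le> y\<close>. No compatibility between metric and order is assumed.\<close>

locale po_complete_metric_space = Metric_space M d
  for M :: "'a set" and d :: "'a \<Rightarrow> 'a \<Rightarrow> real" +
  fixes P :: "'a rel"
  assumes complete: "mcomplete"
    and partial_order: "partial_order_on M P"

text \<open>The sum metric on a product; the library's product metric \<^const>\<open>prod_dist\<close> is the
  Euclidean combination instead.\<close>

definition sum_dist :: "('a \<Rightarrow> 'a \<Rightarrow> real) \<Rightarrow> ('b \<Rightarrow> 'b \<Rightarrow> real) \<Rightarrow> 'a \<times> 'b \<Rightarrow> 'a \<times> 'b \<Rightarrow> real"
  where "sum_dist d1 d2 = (\<lambda>(x, y) (u, v). d1 x u + d2 y v)"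

lemma Metric_space_sum_dist:
  assumes "Metric_space M1 d1" "Metric_space M2 d2"
  shows "Metric_space (M1 \<times> M2) (sum_dist d1 d2)"
proof -
  interpret M1: Metric_space M1 d1 by fact
  interpret M2: Metric_space M2 d2 by fact
  show ?thesis
  proof
    fix p q r
    show "0 \<le> sum_dist d1 d2 p q"
      by (simp add: sum_dist_def case_prod_unfold)
    show "sum_dist d1 d2 p q = sum_dist d1 d2 q p"
      by (simp add: sum_dist_def case_prod_unfold M1.commute M2.commute)
    show "sum_dist d1 d2 p q = 0 \<longleftrightarrow> p = q" if "p \<in> M1 \<times> M2" "q \<in> M1 \<times> M2"
      using that by (auto simp: sum_dist_def add_nonneg_eq_0_iff)
    show "sum_dist d1 d2 p r \<le> sum_dist d1 d2 p q + sum_dist d1 d2 q r"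
      if "p \<in> M1 \<times> M2" "q \<in> M1 \<times> M2" "r \<in> M1 \<times> M2"
    proof -
      have "d1 (fst p) (fst r) \<le> d1 (fst p) (fst q) + d1 (fst q) (fst r)"
        using that by (intro M1.triangle) auto
      moreover have "d2 (snd p) (snd r) \<le> d2 (snd p) (snd q) + d2 (snd q) (snd r)"
        using that by (intro M2.triangle) auto
      ultimately show ?thesis
        by (simp add: sum_dist_def case_prod_unfold)
    qed
  qed
qed

definition mixed_monotone ::
  "'a set \<Rightarrow> 'a rel \<Rightarrow> 'b set \<Rightarrow> 'b rel \<Rightarrow> ('a \<times> 'b \<Rightarrow> 'a) \<Rightarrow> ('b \<times> 'a \<Rightarrow> 'b) \<Rightarrow> bool"
  where "mixed_monotone X P1 Y P2 F G \<longleftrightarrow>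
    (\<forall>x\<in>X. \<forall>y\<in>Y.
      (\<forall>x1\<in>X. \<forall>x2\<in>X. (x1, x2) \<in> P1 \<longrightarrow>
        (F (x1, y), F (x2, y)) \<in> P1 \<and> (G (y, x2), G (y, x1)) \<in> P2) \<and>
      (\<forall>y1\<in>Y. \<forall>y2\<in>Y. (y1, y2) \<in> P2 \<longrightarrow>
        (F (x, y2), F (x, y1)) \<in> P1 \<and> (G (y1, x), G (y2, x)) \<in> P2))"

end

theory Submission
  imports Defs
begin

text \<open>Along the coupled Picard iteration \<open>x (i + 1) = F (x i, y i)\<close>, \<open>y (i + 1) = G (y i, x i)\<close> mixed
  monotonicity makes \<open>x\<close> increasing and \<open>y\<close> decreasing, so the contraction conditions apply to
  consecutive iterates. They bound each step of \<open>x\<close> by \<open>l / (1 - k)\<close> times the preceding one, and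
  each step of \<open>y\<close> by \<open>m / (1 - n)\<close> times the preceding one. Both ratios are below 1, so the iterates
  converge, and continuity of \<open>F\<close> and \<open>G\<close> identifies the limits as a coupled fixed point.\<close>

text \<open>The step lengths are dominated by a geometric series with ratio \<open>c\<close>, so by
  the triangle inequality its tails control the distance between any two later terms. The sequence
  is left arbitrary because both coordinates use the lemma, with ratios that may differ.\<close>

lemma (in Metric_space) MCauchy_geometric_steps:
  assumes range: "range \<sigma> \<subseteq> M"
    and c: "0 \<le> c" "c < 1"
    and step: "\<And>i. d (\<sigma> (Suc i)) (\<sigma> (Suc (Suc i))) \<le> c * d (\<sigma> i) (\<sigma> (Suc i))"
  shows "MCauchy \<sigma>"
proof -
  \<comment> \<open>\<open>K\<close> is the sum of the whole geometric series of step
    bounds.\<close>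
  define K where "K = d (\<sigma> 0) (\<sigma> (Suc 0)) / (1 - c)"
  have K: "0 \<le> K" "K * (1 - c) = d (\<sigma> 0) (\<sigma> (Suc 0))"
    using c by (auto simp: K_def)
  have inM: "\<sigma> i \<in> M" for i
    using range by auto
  have steps: "d (\<sigma> i) (\<sigma> (Suc i)) \<le> K * (1 - c) * c ^ i" for i
  proof (induction i)
    case (Suc i)
    from mult_left_mono[OF Suc c(1)] show ?case
      using step[of i] by (simp add: mult_ac)
  qed (simp add: K)
  \<comment> \<open>The right-hand side is the closed form of the sum of
    \<open>K * (1 - c) * c ^ j\<close> for \<open>j\<close> from \<open>i\<close> to
    \<open>i + p - 1\<close>; keeping the factor \<open>1 - c ^ p\<close> lets the induction
    close.\<close>
  have tail: "d (\<sigma> i) (\<sigma> (i + p)) \<le> K * c ^ i * (1 - c ^ p)" for i p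
  proof (induction p)
    case (Suc p)
    have "d (\<sigma> i) (\<sigma> (i + Suc p)) \<le> d (\<sigma> i) (\<sigma> (i + p)) + d (\<sigma> (i + p)) (\<sigma> (Suc (i + p)))"
      using triangle[OF inM inM inM] by simp
    also have "\<dots> \<le> K * c ^ i * (1 - c ^ p) + K * (1 - c) * c ^ (i + p)"
      by (intro add_mono Suc steps)
    also have "\<dots> = K * c ^ i * (1 - c ^ Suc p)"
      by (simp add: algebra_simps power_add)
    finally show ?case .
  qed (simp add: inM)
  have bound: "d (\<sigma> i) (\<sigma> j) \<le> K * c ^ i" if "i \<le> j" for i j
  proof -
    have "d (\<sigma> i) (\<sigma> j) \<le> K * c ^ i * (1 - c ^ (j - i))"
      using tail[of i "j - i"] that by simp
    also have "\<dots> \<le> K * c ^ i"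
      using K(1) c(1) by (intro mult_right_le_one_le) (auto simp: power_le_one c less_imp_le)
    finally show ?thesis .
  qed
  have lim: "(\<lambda>i. K * c ^ i) \<longlonglongrightarrow> 0"
    using c by (intro tendsto_mult_right_zero LIMSEQ_power_zero) simp
  show ?thesis
    unfolding MCauchy_def
  proof (intro conjI range allI impI)
    fix \<epsilon> :: real
    assume "\<epsilon> > 0"
    then obtain N where N: "\<And>i. i \<ge> N \<Longrightarrow> K * c ^ i < \<epsilon>"
      using order_tendstoD(2)[OF lim] by (auto simp: eventually_sequentially)
    have "d (\<sigma> i) (\<sigma> j) < \<epsilon>" if "N \<le> i" "N \<le> j" for i j
    proof (cases "i \<le> j")
      case True
      then show ?thesis
        using bound[of i j] N[of i] that by simp
    next
      case False
      then show ?thesis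
        using bound[of j i] N[of j] that commute[of "\<sigma> i" "\<sigma> j"] by simp
    qed
    then show "\<exists>N. \<forall>i i'. N \<le> i \<longrightarrow> N \<le> i' \<longrightarrow> d (\<sigma> i) (\<sigma> i') < \<epsilon>"
      by blast
  qed
qed

text \<open>Carries the separate limits of the two coordinates over to the metric in which
  \<open>F\<close> and \<open>G\<close> are continuous: each summand is eventually below half the
  tolerance. It serves both \<open>X \<times> Y\<close> and \<open>Y \<times> X\<close>.\<close>

lemma limitin_sum_dist:
  assumes "Metric_space M1 d1" "Metric_space M2 d2"
    and "limitin (Metric_space.mtopology M1 d1) f a \<F>"
    and "limitin (Metric_space.mtopology M2 d2) g b \<F>"
  shows "limitin (Metric_space.mtopology (M1 \<times> M2) (sum_dist d1 d2)) (\<lambda>i. (f i, g i)) (a, b) \<F>"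
proof -
  interpret M1: Metric_space M1 d1 by fact
  interpret M2: Metric_space M2 d2 by fact
  interpret S: Metric_space "M1 \<times> M2" "sum_dist d1 d2"
    by (intro Metric_space_sum_dist assms)
  show ?thesis
    unfolding S.limitin_metric
  proof (intro conjI allI impI)
    show "(a, b) \<in> M1 \<times> M2"
      using assms(3,4) by (simp add: M1.limitin_metric M2.limitin_metric)
    fix \<epsilon> :: real
    assume "\<epsilon> > 0"
    then have "\<epsilon> / 2 > 0" by simp
    then have "\<forall>\<^sub>F i in \<F>. f i \<in> M1 \<and> d1 (f i) a < \<epsilon> / 2" "\<forall>\<^sub>F i in \<F>. g i \<in> M2 \<and> d2 (g i) b < \<epsilon> / 2"
      using assms(3,4) unfolding M1.limitin_metric M2.limitin_metric by blast+
    then show "\<forall>\<^sub>F i in \<F>. (f i, g i) \<in> M1 \<times> M2 \<and> sum_dist d1 d2 (f i, g i) (a, b) < \<epsilon>"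
      by eventually_elim (auto simp: sum_dist_def)
  qed
qed

theorem theorem2p4:
  fixes X :: "'a set" and dX :: "'a \<Rightarrow> 'a \<Rightarrow> real" and P1 :: "'a rel"
    and Y :: "'b set" and dY :: "'b \<Rightarrow> 'b \<Rightarrow> real" and P2 :: "'b rel"
    and F :: "'a \<times> 'b \<Rightarrow> 'a" and G :: "'b \<times> 'a \<Rightarrow> 'b"
    and k l m n :: real
  assumes X: "po_complete_metric_space X dX P1"
    and Y: "po_complete_metric_space Y dY P2"
    and F_maps: "F \<in> X \<times> Y \<rightarrow> X"
    and G_maps: "G \<in> Y \<times> X \<rightarrow> Y"
    and F_cont: "continuous_map (Metric_space.mtopology (X \<times> Y) (sum_dist dX dY))
                   (Metric_space.mtopology X dX) F"
    and G_cont: "continuous_map (Metric_space.mtopology (Y \<times> X) (sum_dist dY dX))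
                   (Metric_space.mtopology Y dY) G"
    and mixed: "mixed_monotone X P1 Y P2 F G"
    and coeffs: "k \<in> {0..<1/2}" "l \<in> {0..<1/2}" "m \<in> {0..<1/2}" "n \<in> {0..<1/2}"
    and F_contr: "\<And>x u y v. \<lbrakk>x \<in> X; u \<in> X; y \<in> Y; v \<in> Y; (u, x) \<in> P1; (y, v) \<in> P2\<rbrakk> \<Longrightarrow>
           dX (F (x, y)) (F (u, v)) \<le> k * dX x (F (x, y)) + l * dX u (F (u, v))"
    and G_contr: "\<And>x u y v. \<lbrakk>x \<in> X; u \<in> X; y \<in> Y; v \<in> Y; (x, u) \<in> P1; (v, y) \<in> P2\<rbrakk> \<Longrightarrow>
           dY (G (y, x)) (G (v, u)) \<le> m * dY y (G (y, x)) + n * dY v (G (v, u))"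
    and start: "\<exists>x0\<in>X. \<exists>y0\<in>Y. (x0, F (x0, y0)) \<in> P1 \<and> (G (y0, x0), y0) \<in> P2"
  shows "\<exists>x\<in>X. \<exists>y\<in>Y. x = F (x, y) \<and> y = G (y, x)"
proof -
  interpret X: po_complete_metric_space X dX P1 by (rule X)
  interpret Y: po_complete_metric_space Y dY P2 by (rule Y)
  have F_in: "F (a, b) \<in> X" and G_in: "G (b, a) \<in> Y" if "a \<in> X" "b \<in> Y" for a b
    using F_maps G_maps that by auto
  have trans: "trans P1" "trans P2"
    using X.partial_order Y.partial_order by (auto simp: partial_order_on_def preorder_on_def)
  \<comment> \<open>The mixed monotone property moves one argument at a time, so the two moves are
    chained through an intermediate value by transitivity.\<close>
  have F_mono: "(F (a, b), F (a', b')) \<in> P1" and G_mono: "(G (b', a'), G (b, a)) \<in> P2"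
    if "a \<in> X" "a' \<in> X" "b \<in> Y" "b' \<in> Y" "(a, a') \<in> P1" "(b', b) \<in> P2" for a a' b b'
  proof -
    have "(F (a, b), F (a', b)) \<in> P1" "(F (a', b), F (a', b')) \<in> P1"
      "(G (b', a'), G (b, a')) \<in> P2" "(G (b, a'), G (b, a)) \<in> P2"
      using mixed that unfolding mixed_monotone_def by blast+
    then show "(F (a, b), F (a', b')) \<in> P1" "(G (b', a'), G (b, a)) \<in> P2"
      using trans by (meson transD)+
  qed
  obtain x0 y0 where init: "x0 \<in> X" "y0 \<in> Y" "(x0, F (x0, y0)) \<in> P1" "(G (y0, x0), y0) \<in> P2"
    using start by blast
  define z where "z = rec_nat (x0, y0) (\<lambda>_ (a, b). (F (a, b), G (b, a)))"
  define x where "x i = fst (z i)" for i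
  define y where "y i = snd (z i)" for i
  have x_simps: "x 0 = x0" "x (Suc i) = F (x i, y i)" for i
    by (simp_all add: x_def y_def z_def case_prod_unfold)
  have y_simps: "y 0 = y0" "y (Suc i) = G (y i, x i)" for i
    by (simp_all add: x_def y_def z_def case_prod_unfold)
  have xy_in: "x i \<in> X \<and> y i \<in> Y" for i
    by (induction i) (auto simp: x_simps y_simps init F_in G_in)
  then have x_in: "x i \<in> X" and y_in: "y i \<in> Y" for i
    by blast+
  \<comment> \<open>The two orderings need a joint induction, since \<open>F_mono\<close> and
    \<open>G_mono\<close> each require both of them.\<close>
  have "(x i, x (Suc i)) \<in> P1 \<and> (y (Suc i), y i) \<in> P2" for i
  proof (induction i)
    case 0
    then show ?case using init by (simp add: x_simps y_simps)
  next
    case (Suc i)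
    then show ?case
      using F_mono[of "x i" "x (Suc i)" "y i" "y (Suc i)", OF x_in x_in y_in y_in]
        G_mono[of "x i" "x (Suc i)" "y i" "y (Suc i)", OF x_in x_in y_in y_in]
      by (simp add: x_simps(2) y_simps(2))
  qed
  then have x_incr: "(x i, x (Suc i)) \<in> P1" and y_decr: "(y (Suc i), y i) \<in> P2" for i
    by blast+

  have "X.MCauchy x"
  proof (rule X.MCauchy_geometric_steps)
    show "dX (x (Suc i)) (x (Suc (Suc i))) \<le> l / (1 - k) * dX (x i) (x (Suc i))" for i
    proof -
      \<comment> \<open>The newer iterate is the larger one and takes the first role in
        \<open>F_contr\<close>, so \<open>k\<close> multiplies the new step; absorbing that term on
        the left gives the ratio \<open>l / (1 - k)\<close>.\<close>
      have "dX (x (Suc (Suc i))) (x (Suc i))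
          \<le> k * dX (x (Suc i)) (x (Suc (Suc i))) + l * dX (x i) (x (Suc i))"
        using F_contr[OF x_in x_in y_in y_in x_incr y_decr, of i i]
        by (simp only: x_simps(2)[symmetric])
      then show ?thesis
        using coeffs X.commute[of "x (Suc i)" "x (Suc (Suc i))"] by (simp add: field_simps)
    qed
  \<comment> \<open>The ratio is below 1 because \<open>k + l < 1\<close>.\<close>
  qed (use x_in coeffs in \<open>auto simp: field_simps\<close>)
  then obtain a where a: "limitin X.mtopology x a sequentially"
    using X.complete by (auto simp: X.mcomplete_def)
  have "Y.MCauchy y"
  proof (rule Y.MCauchy_geometric_steps)
    show "dY (y (Suc i)) (y (Suc (Suc i))) \<le> m / (1 - n) * dY (y i) (y (Suc i))" for i
    proof -
      \<comment> \<open>As \<open>y\<close> decreases, the older iterate now takes the first role,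
        so it is \<open>n\<close> that multiplies the new step and is absorbed.\<close>
      have "dY (y (Suc i)) (y (Suc (Suc i)))
          \<le> m * dY (y i) (y (Suc i)) + n * dY (y (Suc i)) (y (Suc (Suc i)))"
        using G_contr[OF x_in x_in y_in y_in x_incr y_decr, of i i]
        by (simp only: y_simps(2)[symmetric])
      then show ?thesis
        using coeffs by (simp add: field_simps)
    qed
  qed (use y_in coeffs in \<open>auto simp: field_simps\<close>)
  then obtain b where b: "limitin Y.mtopology y b sequentially"
    using Y.complete by (auto simp: Y.mcomplete_def)

  \<comment> \<open>Applying \<open>F\<close> to the pairs of iterates yields \<open>x\<close>
    shifted by one, which therefore tends both to \<open>F (a, b)\<close> and to \<open>a\<close>;
    uniqueness of limits equates them.\<close>
  have "limitin X.mtopology (F \<circ> (\<lambda>i. (x i, y i))) (F (a, b)) sequentially"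
    by (intro continuous_map_limit[OF F_cont] limitin_sum_dist X.Metric_space_axioms
        Y.Metric_space_axioms a b)
  moreover have "F \<circ> (\<lambda>i. (x i, y i)) = (\<lambda>i. x (Suc i))"
    by (simp add: fun_eq_iff x_simps)
  moreover have "limitin X.mtopology (\<lambda>i. x (Suc i)) a sequentially"
    using limitin_sequentially_offset[OF a, of 1] by simp
  ultimately have "a = F (a, b)"
    using X.limitin_metric_unique by fastforce
  have "limitin Y.mtopology (G \<circ> (\<lambda>i. (y i, x i))) (G (b, a)) sequentially"
    by (intro continuous_map_limit[OF G_cont] limitin_sum_dist X.Metric_space_axioms
        Y.Metric_space_axioms a b)
  moreover have "G \<circ> (\<lambda>i. (y i, x i)) = (\<lambda>i. y (Suc i))"
    by (simp add: fun_eq_iff y_simps)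
  moreover have "limitin Y.mtopology (\<lambda>i. y (Suc i)) b sequentially"
    using limitin_sequentially_offset[OF b, of 1] by simp
  ultimately have "b = G (b, a)"
    using Y.limitin_metric_unique by fastforce
  with \<open>a = F (a, b)\<close> a b show ?thesis
    using X.limitin_mspace Y.limitin_mspace by blast
qed

end
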